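(* Let $N\ge 1$, let $T:\mathbb{R}_+^N\to\mathbb{R}_{++}^N$ be a continuous concave mapping, and let $\|\cdot\|_a$ and $\|\cdot\|_b$ be monotone norms on $\mathbb{R}^N$. Let $E:\mathbb{R}_{++}\to\mathbb{R}_{++}$ be the $\|\cdot\|_b$-energy efficiency function associated with the canonical utility maximization problem for $T$ and $\|\cdot\|_a$. Then $E$ is non-increasing; i.e., $$(\forall \bar{p}'\in\mathbb{R}_{++})(\forall \bar{p}''\in\mathbb{R}_{++})\quad \bar{p}'>\bar{p}''\ \Rightarrow\ E(\bar{p}')\le E(\bar{p}'').$$
   Context: Notation: $\mathbb{R}_+=[0,\infty)$, $\mathbb{R}_{++}=(0,\infty)$; vector inequalities are entrywise. A mapping $T:\mathbb{R}_+^N\to\mathbb{R}^N$ is concave if $T(\alpha x+(1-\alpha)y)\ge \alpha T(x)+(1-\alpha)T(y)$ for all $x,y\in\mathbb{R}_+^N$, $\alpha\in(0,1)$. A norm $\|\cdot\|$ on $\mathbb{R}^N$ is monotone if for all $x,y\in\mathbb{R}_+^N$, $x\ge y$ implies $\|x\|\ge\|y\|$. Canonical utility maximization problem: given a power budget $\bar p\in\mathbb{R}_{++}$, maximize $c$ over $(p,c)\in\mathbb{R}_+^N\times\mathbb{R}_{++}$ subject to $p=cT(p)$ and $\|p\|_a\le\bar p$. It is known that for every $\bar p>0$ this problem has a unique solution $(p^\star_{\bar p},c^\star_{\bar p})\in\mathbb{R}_{++}^N\times\mathbb{R}_{++}$, and that it is also the unique pair satisfying $T(p)=\frac1c p$ and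 $\|p\|_a=\bar p$. The utility function is $U:\mathbb{R}_{++}\to\mathbb{R}_{++}$, $U(\bar p)=c^\star_{\bar p}$, and the power function is $P:\mathbb{R}_{++}\to\mathbb{R}_{++}^N$, $P(\bar p)=p^\star_{\bar p}$. The $\|\cdot\|_b$-energy efficiency function is $E:\mathbb{R}_{++}\to\mathbb{R}_{++}$, $E(\bar p)=U(\bar p)/\|P(\bar p)\|_b$ (equivalently $1/\|T(P(\bar p))\|_b$). *)

theory Defs
  imports "HOL-Analysis.Analysis"
begin

text \<open>The order \<open>\<le>\<close> on \<^typ>\<open>real ^ 'n\<close> is the entrywise one, but \<open><\<close> on this type is not
  entrywise strict; hence the explicit quantifier in \<open>pos_orthant\<close>.\<close>

definition nonneg_orthant :: "(real ^ 'n) set"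
  where "nonneg_orthant = {x. 0 \<le> x}"

definition pos_orthant :: "(real ^ 'n) set"
  where "pos_orthant = {x. \<forall>i. 0 < x $ i}"

definition concave_mapping :: "(real ^ 'n \<Rightarrow> real ^ 'n) \<Rightarrow> bool"
  where "concave_mapping T \<longleftrightarrow>
    (\<forall>x\<in>nonneg_orthant. \<forall>y\<in>nonneg_orthant. \<forall>\<alpha>::real. 0 < \<alpha> \<and> \<alpha> < 1 \<longrightarrow>
       \<alpha> *\<^sub>R T x + (1 - \<alpha>) *\<^sub>R T y \<le> T (\<alpha> *\<^sub>R x + (1 - \<alpha>) *\<^sub>R y))"

text \<open>An arbitrary norm on the vector space, not tied to the type class constant
  \<^const>\<open>norm\<close>, which is fixed to the Euclidean norm on \<^typ>\<open>real ^ 'n\<close>.\<close>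

definition is_norm :: "(real ^ 'n \<Rightarrow> real) \<Rightarrow> bool"
  where "is_norm \<nu> \<longleftrightarrow>
    (\<forall>x. 0 \<le> \<nu> x) \<and>
    (\<forall>x. \<nu> x = 0 \<longleftrightarrow> x = 0) \<and>
    (\<forall>a x. \<nu> (a *\<^sub>R x) = \<bar>a\<bar> * \<nu> x) \<and>
    (\<forall>x y. \<nu> (x + y) \<le> \<nu> x + \<nu> y)"

definition monotone_norm :: "(real ^ 'n \<Rightarrow> real) \<Rightarrow> bool"
  where "monotone_norm \<nu> \<longleftrightarrow>
    is_norm \<nu> \<and> (\<forall>x\<in>nonneg_orthant. \<forall>y\<in>nonneg_orthant. y \<le> x \<longrightarrow> \<nu> y \<le> \<nu> x)"

definition feasible ::
  "(real ^ 'n \<Rightarrow> real ^ 'n) \<Rightarrow> (real ^ 'n \<Rightarrow> real) \<Rightarrow> real \<Rightarrow> (real ^ 'n) \<times> real \<Rightarrow> bool"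
  where "feasible T \<nu> pbar = (\<lambda>(p, c).
    p \<in> nonneg_orthant \<and> 0 < c \<and> p = c *\<^sub>R T p \<and> \<nu> p \<le> pbar)"

text \<open>For \<open>pbar > 0\<close>, a continuous concave \<open>T\<close> into the positive orthant and a monotone norm,
  the maximizer exists and is unique, so \<open>THE\<close> denotes it; for \<open>pbar \<le> 0\<close> the value
  is unspecified.\<close>

definition solution ::
  "(real ^ 'n \<Rightarrow> real ^ 'n) \<Rightarrow> (real ^ 'n \<Rightarrow> real) \<Rightarrow> real \<Rightarrow> (real ^ 'n) \<times> real"
  where "solution T \<nu> pbar = (THE s. is_arg_max snd (feasible T \<nu> pbar) s)"

definition power_fun ::
  "(real ^ 'n \<Rightarrow> real ^ 'n) \<Rightarrow> (real ^ 'n \<Rightarrow> real) \<Rightarrow> real \<Rightarrow> real ^ 'n"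
  where "power_fun T \<nu> pbar = fst (solution T \<nu> pbar)"

definition utility_fun ::
  "(real ^ 'n \<Rightarrow> real ^ 'n) \<Rightarrow> (real ^ 'n \<Rightarrow> real) \<Rightarrow> real \<Rightarrow> real"
  where "utility_fun T \<nu> pbar = snd (solution T \<nu> pbar)"

definition energy_efficiency ::
  "(real ^ 'n \<Rightarrow> real ^ 'n) \<Rightarrow> (real ^ 'n \<Rightarrow> real) \<Rightarrow> (real ^ 'n \<Rightarrow> real) \<Rightarrow> real \<Rightarrow> real"
  where "energy_efficiency T \<nu>a \<nu>b pbar = utility_fun T \<nu>a pbar / \<nu>b (power_fun T \<nu>a pbar)"

end

theory Submission
  imports Defs
begin

text \<open>A concave mapping that is positive on the nonnegative orthant is monotone and satisfies
  \<open>T (\<mu> x) < \<mu> T x\<close> for \<open>\<mu> > 1\<close>. Hence, if \<open>p = c T p\<close> and \<open>q = d T q\<close> with \<open>c \<le> d\<close>, then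
  \<open>p \<le> q\<close>: otherwise take the least \<open>\<mu>\<close> with \<open>p \<le> \<mu> q\<close>; it exceeds 1 and the two properties
  allow decreasing it. A solution of \<open>p = c T p\<close> whose norm exhausts the budget exists by
  Brouwer's theorem, and by the comparison it is the unique maximizer. A larger budget therefore
  gives a larger \<open>p\<close>, so a larger \<open>T p\<close>, and the energy efficiency is the inverse of the norm
  of \<open>T p\<close>.\<close>

lemma nonneg_orthant_iff: "x \<in> nonneg_orthant \<longleftrightarrow> (\<forall>i. 0 \<le> x $ i)"
  by (simp add: nonneg_orthant_def less_eq_vec_def)

lemma pos_orthant_subset_nonneg: "pos_orthant \<subseteq> nonneg_orthant"
  by (simp add: subset_iff nonneg_orthant_iff pos_orthant_def order_less_imp_le)

lemma monotone_normD:
  assumes "monotone_norm \<nu>" "y \<in> nonneg_orthant" "y \<le> x"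
  shows "\<nu> y \<le> \<nu> x"
proof -
  have "x \<in> nonneg_orthant"
    using assms(2,3) by (auto simp: nonneg_orthant_def)
  then show ?thesis
    using assms by (auto simp: monotone_norm_def)
qed

lemma is_norm_scaleR: "is_norm \<nu> \<Longrightarrow> \<nu> (a *\<^sub>R x) = \<bar>a\<bar> * \<nu> x"
  by (simp add: is_norm_def)

lemma is_norm_pos: "is_norm \<nu> \<Longrightarrow> x \<noteq> 0 \<Longrightarrow> 0 < \<nu> x"
  by (metis is_norm_def order_le_less)

text \<open>The triangle inequality and homogeneity make \<open>\<nu>\<close> convex, and a convex
  function on the whole finite-dimensional space is continuous.\<close>

lemma continuous_on_is_norm:
  fixes \<nu> :: "real ^ 'n \<Rightarrow> real"
  assumes "is_norm \<nu>"
  shows "continuous_on A \<nu>"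
proof -
  have "convex_on UNIV \<nu>"
  proof (rule convex_onI)
    fix t :: real and x y assume t: "0 < t" "t < 1"
    have "\<nu> ((1 - t) *\<^sub>R x + t *\<^sub>R y) \<le> \<nu> ((1 - t) *\<^sub>R x) + \<nu> (t *\<^sub>R y)"
      using assms unfolding is_norm_def by blast
    also have "\<dots> = (1 - t) * \<nu> x + t * \<nu> y"
      using t by (simp add: is_norm_scaleR[OF assms])
    finally show "\<nu> ((1 - t) *\<^sub>R x + t *\<^sub>R y) \<le> (1 - t) * \<nu> x + t * \<nu> y" .
  qed simp
  then show ?thesis
    using convex_on_continuous[of UNIV \<nu>] continuous_on_subset by blast
qed

locale positive_concave =
  fixes T :: "real ^ 'n \<Rightarrow> real ^ 'n"
  assumes pos: "T ` nonneg_orthant \<subseteq> pos_orthant"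
    and concave: "concave_mapping T"
begin

lemma T_pos: "x \<in> nonneg_orthant \<Longrightarrow> 0 < T x $ i"
  using pos by (auto simp: pos_orthant_def)

lemma T_nonneg: "x \<in> nonneg_orthant \<Longrightarrow> T x \<in> nonneg_orthant"
  using pos pos_orthant_subset_nonneg by blast

lemma T_concave:
  assumes "x \<in> nonneg_orthant" "y \<in> nonneg_orthant" "0 < \<alpha>" "\<alpha> < 1"
  shows "\<alpha> * T x $ i + (1 - \<alpha>) * T y $ i \<le> T (\<alpha> *\<^sub>R x + (1 - \<alpha>) *\<^sub>R y) $ i"
proof -
  have "\<alpha> *\<^sub>R T x + (1 - \<alpha>) *\<^sub>R T y \<le> T (\<alpha> *\<^sub>R x + (1 - \<alpha>) *\<^sub>R y)"
    using concave assms unfolding concave_mapping_def by blast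
  then show ?thesis
    by (simp add: less_eq_vec_def)
qed

text \<open>For \<open>x \<le> y\<close> and \<open>\<alpha> < 1\<close>, the point \<open>y\<close> is a convex combination of \<open>x\<close>, with weight \<open>\<alpha>\<close>,
  and a nonnegative vector, so that \<open>\<alpha> T x \<le> T y\<close>.\<close>

lemma T_mono:
  assumes x: "x \<in> nonneg_orthant" and le: "x \<le> y"
  shows "T x \<le> T y"
  unfolding less_eq_vec_def
proof
  fix i
  show "T x $ i \<le> T y $ i"
  \<comment> \<open>Letting \<alpha> tend to 1 removes the factor \<alpha>.\<close>
  proof (rule field_le_mult_one_interval)
    fix \<alpha> :: real assume \<alpha>: "0 < \<alpha>" "\<alpha> < 1"
    define z where "z = inverse (1 - \<alpha>) *\<^sub>R (y - \<alpha> *\<^sub>R x)"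
    have "\<alpha> * x $ j \<le> y $ j" for j
    proof -
      have "\<alpha> * x $ j \<le> 1 * x $ j"
        using x \<alpha> by (intro mult_right_mono) (auto simp: nonneg_orthant_iff)
      then show ?thesis
        using le by (metis less_eq_vec_def mult_1 order_trans)
    qed
    then have z: "z \<in> nonneg_orthant"
      using \<alpha> by (simp add: z_def nonneg_orthant_iff)
    have "y = \<alpha> *\<^sub>R x + (1 - \<alpha>) *\<^sub>R z"
      using \<alpha> by (simp add: z_def)
    then have "\<alpha> * T x $ i + (1 - \<alpha>) * T z $ i \<le> T y $ i"
      using T_concave[OF x z \<alpha>] by simp
    then show "\<alpha> * T x $ i \<le> T y $ i"
      using T_pos[OF z, of i] \<alpha> by (smt (verit) mult_nonneg_nonneg)
  qed
qed

text \<open>\<open>x\<close> is the convex combination of \<open>\<mu> *\<^sub>R x\<close> and 0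
  with weights 1/\<mu> and 1 - 1/\<mu>; strictness comes from the positivity of
  \<open>T 0\<close>.\<close>

lemma T_scale:
  assumes x: "x \<in> nonneg_orthant" and \<mu>: "1 < \<mu>"
  shows "T (\<mu> *\<^sub>R x) $ i < \<mu> * T x $ i"
proof -
  have 0: "0 \<in> nonneg_orthant" and \<mu>x: "\<mu> *\<^sub>R x \<in> nonneg_orthant"
    using x \<mu> by (auto simp: nonneg_orthant_iff)
  have "inverse \<mu> * T (\<mu> *\<^sub>R x) $ i + (1 - inverse \<mu>) * T 0 $ i \<le> T x $ i"
    using T_concave[OF \<mu>x 0, of "inverse \<mu>" i] \<mu> by (simp add: inverse_less_1_iff)
  moreover have "0 < (1 - inverse \<mu>) * T 0 $ i"
    using T_pos[OF 0, of i] \<mu> by (simp add: inverse_less_1_iff)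
  ultimately have "inverse \<mu> * T (\<mu> *\<^sub>R x) $ i < T x $ i"
    by linarith
  then show ?thesis
    using \<mu> by (simp add: field_simps)
qed

lemma eigen_mono:
  assumes p: "p \<in> nonneg_orthant" "p = c *\<^sub>R T p" and c: "0 < c"
    and q: "q \<in> nonneg_orthant" "q = d *\<^sub>R T q" and cd: "c \<le> d"
  shows "p \<le> q"
proof -
  \<comment> \<open>Since \<open>q\<close> has positive entries, this is the least factor with
    \<open>p \<le> \<mu> *\<^sub>R q\<close>; equality holds at an index \<open>k\<close> attaining
    the maximum, and there the contradiction arises.\<close>
  define \<mu> where "\<mu> = Max (range (\<lambda>i. p $ i / q $ i))"
  have p_eq: "p $ i = c * T p $ i" for i
    by (subst p(2)) simp
  have q_eq: "q $ i = d * T q $ i" for i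
    by (subst q(2)) simp
  have q_pos: "0 < q $ i" for i
    using q_eq[of i] T_pos[OF q(1), of i] c cd by simp
  have le: "p $ i \<le> \<mu> * q $ i" for i
  proof -
    have "p $ i / q $ i \<le> \<mu>"
      unfolding \<mu>_def by (rule Max_ge) auto
    then show ?thesis
      using q_pos[of i] by (simp add: field_simps)
  qed
  have "\<mu> \<in> range (\<lambda>i. p $ i / q $ i)"
    unfolding \<mu>_def by (rule Max_in) auto
  then obtain k where "\<mu> = p $ k / q $ k"
    by blast
  then have k: "p $ k = \<mu> * q $ k"
    using q_pos[of k] by simp
  have "\<mu> \<le> 1"
  proof (rule ccontr)
    assume "\<not> \<mu> \<le> 1"
    then have \<mu>: "1 < \<mu>" by simp
    have "p \<le> \<mu> *\<^sub>R q"
      using le by (simp add: less_eq_vec_def)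
    then have "T p $ k \<le> T (\<mu> *\<^sub>R q) $ k"
      using T_mono[OF p(1)] by (simp add: less_eq_vec_def)
    also have "\<dots> < \<mu> * T q $ k"
      by (rule T_scale[OF q(1) \<mu>])
    finally have "p $ k < c * (\<mu> * T q $ k)"
      using c by (simp add: p_eq)
    also have "\<dots> \<le> d * (\<mu> * T q $ k)"
      using cd \<mu> T_pos[OF q(1), of k] by (intro mult_right_mono) auto
    also have "\<dots> = p $ k"
      using k q_eq[of k] by simp
    finally show False by simp
  qed
  then have "\<mu> * q $ i \<le> q $ i" for i
    using q_pos[of i] by simp
  then show ?thesis
    using le order_trans unfolding less_eq_vec_def by blast
qed

text \<open>Brouwer's theorem is applied on the standard simplex, with the budget sphere parametrized
  by \<open>x \<mapsto> (b / \<nu> x) x\<close>; only the continuity of \<open>\<nu>\<close> is needed then.\<close>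

lemma ex_eigen:
  fixes \<nu> :: "real ^ 'n \<Rightarrow> real"
  assumes cont: "continuous_on nonneg_orthant T" and \<nu>: "is_norm \<nu>" and b: "0 < b"
  shows "\<exists>p c. p \<in> nonneg_orthant \<and> 0 < c \<and> p = c *\<^sub>R T p \<and> \<nu> p = b"
proof -
  define S where "S = {x :: real ^ 'n. x \<in> nonneg_orthant \<and> (\<Sum>i\<in>UNIV. x $ i) = 1}"
  define g where "g x = (b / \<nu> x) *\<^sub>R x" for x
  define s where "s x = (\<Sum>i\<in>UNIV. T x $ i)" for x
  \<comment> \<open>Dividing by the entry sum brings \<open>T (g x)\<close> back to the simplex. At
    a fixed point, \<open>T (g x)\<close> is a positive multiple of \<open>x\<close>, hence of
    \<open>g x\<close>.\<close>
  define f where "f x = inverse (s (g x)) *\<^sub>R T (g x)" for x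
  have S_eq: "S = cbox 0 1 \<inter> {x. (\<Sum>i\<in>UNIV. x $ i) = 1}"
  proof -
    have "x $ i \<le> 1" if "\<forall>i. 0 \<le> x $ i" "(\<Sum>i\<in>UNIV. x $ i) = 1" for x :: "real ^ 'n" and i
      using member_le_sum[of i UNIV "\<lambda>i. x $ i"] that by simp
    then show ?thesis
      by (auto simp: S_def nonneg_orthant_iff mem_box_cart)
  qed
  have "closed {x :: real ^ 'n. (\<Sum>i\<in>UNIV. x $ i) = 1}"
    by (intro closed_Collect_eq continuous_intros)
  then have compact: "compact S"
    unfolding S_eq by (intro compact_Int_closed compact_cbox)
  have convex: "convex S"
    by (rule convexI)
       (auto simp: S_def nonneg_orthant_iff sum.distrib simp flip: sum_distrib_left)
  have "(\<chi> i. 1 / real CARD('n)) \<in> S"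
    by (simp add: S_def nonneg_orthant_iff)
  then have ne: "S \<noteq> {}" by blast
  have \<nu>_pos: "0 < \<nu> x" if "x \<in> S" for x
    using that by (intro is_norm_pos[OF \<nu>]) (auto simp: S_def)
  have g_nonneg: "g x \<in> nonneg_orthant" if "x \<in> S" for x
    using that \<nu>_pos[OF that] b by (auto simp: g_def S_def nonneg_orthant_iff)
  have s_pos: "0 < s x" if "x \<in> nonneg_orthant" for x
    unfolding s_def using T_pos[OF that] by (intro sum_pos) auto
  have "continuous_on S g"
    unfolding g_def using \<nu>_pos
    by (intro continuous_intros continuous_on_is_norm[OF \<nu>]) force
  then have Tg: "continuous_on S (\<lambda>x. T (g x))"
    using cont g_nonneg by (intro continuous_on_compose2[OF cont]) auto
  have "continuous_on S f"
    unfolding f_def s_def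
  proof (intro continuous_intros Tg ballI)
    fix x assume "x \<in> S"
    then show "(\<Sum>i\<in>UNIV. T (g x) $ i) \<noteq> 0"
      using s_pos[OF g_nonneg] by (force simp: s_def)
  qed
  moreover have "f \<in> S \<rightarrow> S"
  proof
    fix x assume "x \<in> S"
    then have pos: "0 < s (g x)" and nn: "T (g x) \<in> nonneg_orthant"
      using s_pos g_nonneg T_nonneg by auto
    then have "(\<Sum>i\<in>UNIV. f x $ i) = inverse (s (g x)) * s (g x)"
      by (simp add: f_def s_def sum_distrib_left)
    then show "f x \<in> S"
      using pos nn by (simp add: S_def f_def nonneg_orthant_iff)
  qed
  ultimately obtain x where x: "x \<in> S" "f x = x"
    using brouwer[OF compact convex ne] by blast
  have sx: "0 < s (g x)"
    using x by (intro s_pos g_nonneg)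
  have "g x = (b / \<nu> x / s (g x)) *\<^sub>R T (g x)"
    using x(2) unfolding f_def g_def[of x, symmetric]
    by (metis divide_inverse g_def scaleR_scaleR)
  moreover have "0 < b / \<nu> x / s (g x)"
    using b \<nu>_pos[OF x(1)] sx by simp
  moreover have "\<nu> (g x) = b"
    using b \<nu>_pos[OF x(1)] by (simp add: g_def is_norm_scaleR[OF \<nu>])
  ultimately show ?thesis
    using g_nonneg[OF x(1)] by blast
qed

text \<open>A feasible \<open>(q, d)\<close> with \<open>d > c\<close> would have
  \<open>q \<ge> p\<close>, hence \<open>T q \<ge> T p\<close>, and its norm
  \<open>d * \<nu> (T q)\<close> would exceed \<open>c * \<nu> (T p) = b\<close>.\<close>

lemma solution_eqI:
  fixes \<nu> :: "real ^ 'n \<Rightarrow> real"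
  assumes \<nu>: "monotone_norm \<nu>"
    and p: "p \<in> nonneg_orthant" "0 < c" "p = c *\<^sub>R T p" "\<nu> p = b"
  shows "solution T \<nu> b = (p, c)"
proof -
  have norm: "is_norm \<nu>"
    using \<nu> by (simp add: monotone_norm_def)
  have feas: "feasible T \<nu> b (p, c)"
    using p unfolding feasible_def by simp
  have max: "d \<le> c" if "feasible T \<nu> b (q, d)" for q d
  proof (rule ccontr)
    assume "\<not> d \<le> c"
    then have cd: "c < d" by simp
    from that have q: "q \<in> nonneg_orthant" "q = d *\<^sub>R T q" "\<nu> q \<le> b"
      unfolding feasible_def by auto
    have "T p \<le> T q"
      using T_mono[OF p(1) eigen_mono[OF p(1,3,2) q(1,2)]] cd by simp
    then have le: "\<nu> (T p) \<le> \<nu> (T q)"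
      by (rule monotone_normD[OF \<nu> T_nonneg[OF p(1)]])
    have "T q \<noteq> 0"
      using T_pos[OF q(1)] by (metis less_irrefl zero_index)
    then have "0 < \<nu> (T q)"
      by (rule is_norm_pos[OF norm])
    have "b = c * \<nu> (T p)"
      using p(2,4) is_norm_scaleR[OF norm, of c "T p"] p(3) by simp
    also have "\<dots> \<le> c * \<nu> (T q)"
      using le p(2) by simp
    also have "\<dots> < d * \<nu> (T q)"
      using cd \<open>0 < \<nu> (T q)\<close> by simp
    also have "\<dots> = \<nu> q"
      using p(2) cd is_norm_scaleR[OF norm, of d "T q"] q(2) by simp
    finally show False
      using q(3) by simp
  qed
  show ?thesis
    unfolding solution_def
  proof (rule the_equality)
    show "is_arg_max snd (feasible T \<nu> b) (p, c)"
      using feas max by (force simp: is_arg_max_def not_less)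
  next
    fix r assume r: "is_arg_max snd (feasible T \<nu> b) r"
    obtain q d where [simp]: "r = (q, d)"
      by (cases r)
    have feas': "feasible T \<nu> b (q, d)" and "c \<le> d"
      using r feas by (auto simp: is_arg_max_def not_less)
    with max have [simp]: "d = c"
      by (simp add: order_antisym)
    from feas' have "q \<in> nonneg_orthant" "q = c *\<^sub>R T q"
      unfolding feasible_def by auto
    \<comment> \<open>With equal factors, \<open>eigen_mono\<close> applies in both
      directions.\<close>
    then have "q = p"
      using eigen_mono p(1-3) by (metis order_antisym order_refl)
    then show "r = (p, c)"
      by simp
  qed
qed

text \<open>The factor \<open>c\<close> cancels in the quotient of \<open>c\<close> by
  \<open>\<nu>b (c *\<^sub>R T p)\<close>. Any pair that exhausts the budget can thus replace the
  definite description in \<open>solution\<close>.\<close>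

lemma energy_efficiency_eq:
  fixes \<nu>a \<nu>b :: "real ^ 'n \<Rightarrow> real"
  assumes "monotone_norm \<nu>a" "monotone_norm \<nu>b"
    and p: "p \<in> nonneg_orthant" "0 < c" "p = c *\<^sub>R T p" "\<nu>a p = b"
  shows "energy_efficiency T \<nu>a \<nu>b b = 1 / \<nu>b (T p)"
proof -
  have "\<nu>b p = c * \<nu>b (T p)"
    using is_norm_scaleR[of \<nu>b c "T p"] assms(2) p(2,3) by (simp add: monotone_norm_def)
  then show ?thesis
    using p(2)
    by (simp add: energy_efficiency_def utility_fun_def power_fun_def solution_eqI[OF assms(1) p])
qed

end

theorem lemma1:
  fixes T :: "real ^ 'n \<Rightarrow> real ^ 'n"
    and norm_a norm_b :: "real ^ 'n \<Rightarrow> real"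
  assumes "T ` nonneg_orthant \<subseteq> pos_orthant"
    and "continuous_on nonneg_orthant T"
    and "concave_mapping T"
    and "monotone_norm norm_a"
    and "monotone_norm norm_b"
  shows "\<forall>p'>0. \<forall>p''>0. p' > p'' \<longrightarrow>
    energy_efficiency T norm_a norm_b p' \<le> energy_efficiency T norm_a norm_b p''"
proof (intro allI impI)
  interpret positive_concave T
    using assms by unfold_locales
  have norm: "is_norm norm_a" "is_norm norm_b"
    using assms by (auto simp: monotone_norm_def)
  fix b1 b2 :: real assume b: "0 < b1" "0 < b2" "b2 < b1"
  obtain p c where p: "p \<in> nonneg_orthant" "0 < c" "p = c *\<^sub>R T p" "norm_a p = b1"
    using ex_eigen[OF assms(2) norm(1) b(1)] by blast
  obtain q d where q: "q \<in> nonneg_orthant" "0 < d" "q = d *\<^sub>R T q" "norm_a q = b2"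
    using ex_eigen[OF assms(2) norm(1) b(2)] by blast
  \<comment> \<open>Otherwise monotonicity of \<open>norm_a\<close> would give
    \<open>b1 \<le> b2\<close>. By contraposition of \<open>eigen_mono\<close>,
    \<open>c \<le> d\<close> is then impossible, so the larger budget has the larger
    utility.\<close>
  have "\<not> p \<le> q"
    using monotone_normD[OF assms(4) p(1)] p(4) q(4) b(3) by force
  then have "d \<le> c"
    using eigen_mono[OF p(1,3,2) q(1,3)] by linarith
  then have "T q \<le> T p"
    by (intro T_mono q(1) eigen_mono[OF q(1,3,2) p(1,3)])
  then have "norm_b (T q) \<le> norm_b (T p)"
    by (rule monotone_normD[OF assms(5) T_nonneg[OF q(1)]])
  moreover have "0 < norm_b (T q)"
    using T_pos[OF q(1)] by (intro is_norm_pos[OF norm(2)]) (metis less_irrefl zero_index)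
  ultimately show "energy_efficiency T norm_a norm_b b1 \<le> energy_efficiency T norm_a norm_b b2"
    unfolding energy_efficiency_eq[OF assms(4,5) p] energy_efficiency_eq[OF assms(4,5) q]
    by (intro divide_left_mono) auto
qed

end
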